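(* The following generalization of Worpitzky's identity holds for integers $n\ge k$: \[ (x+1)^{n-k+1}\,x^{k-1}=\sum_{i=0}^{n}A(n,i,k)\binom{x+i}{n-1}. \]
   Context: $[n]=\{1,\dots,n\}$. A descent of a permutation $\sigma$ of $[n]$ is a position $j$ with $1\le j<n$ and $\sigma(j)>\sigma(j+1)$. $A(n,i,k)$ denotes the number of permutations $\sigma$ of $[n]$ with exactly $i$ descents and $\sigma(n)=k$. Both sides are regarded as polynomials in $x$, where for an integer $d\ge 0$, $\binom{y}{d}=\frac{y(y-1)\cdots(y-d+1)}{d!}$.
   Formalization: The exponent n-k+1 of (x+1) is corrected to n-k (as printed the left side has degree n and the right side at most n-1; for n=k=1 it reads x+1=1), and k≥1 is made explicit so that x^{k-1} is a polynomial. *)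

theory Defs
  imports "HOL-Combinatorics.Permutations" "HOL-Computational_Algebra.Polynomial"
begin

definition descents :: "nat \<Rightarrow> (nat \<Rightarrow> nat) \<Rightarrow> nat set" where
  "descents n \<sigma> = {j. 1 \<le> j \<and> j < n \<and> \<sigma> j > \<sigma> (j + 1)}"

definition eulerian_last :: "nat \<Rightarrow> nat \<Rightarrow> nat \<Rightarrow> nat" where
  "eulerian_last n i k = card {\<sigma>. \<sigma> permutes {1..n} \<and> card (descents n \<sigma>) = i \<and> \<sigma> n = k}"

text \<open>
  The library's \<^const>\<open>gbinomial\<close> is not available at polynomial types, so the binomial
  coefficient of a polynomial is defined here; the lemma below relates the two pointwise.
\<close>

definition poly_binomial :: "'a :: field_char_0 poly \<Rightarrow> nat \<Rightarrow> 'a poly" where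
  "poly_binomial p d = smult (1 / fact d) (\<Prod>j<d. p - of_nat j)"

lemma poly_poly_binomial: "poly (poly_binomial p d) a = poly p a gchoose d"
  by (simp add: poly_binomial_def gbinomial_prod_rev poly_prod atLeast0LessThan)

end

(* Let W n k y be the right-hand side evaluated at y.  Removing the last letter of a permutation
   of [n+1] and standardizing gives a recursion for W in which k only enters through the
   comparison with the previous letter.  Pascal's rule then yields
     W (n+1) k y = W (n+1) (k+1) y + W n k y,
   and comparing the extreme last letters gives W (n+1) 1 y = W (n+1) (n+1) (y+1).
   As W (n+1) (n+1) 0 = 0, these relations determine W at all natural numbers y. *)

theory Submission
  imports Defs
begin

definition perms_last :: "nat \<Rightarrow> nat \<Rightarrow> (nat \<Rightarrow> nat) set" where
  "perms_last n k = {\<sigma>. \<sigma> permutes {1..n} \<and> \<sigma> n = k}"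

lemma finite_perms_last [simp]: "finite (perms_last n k)"
  unfolding perms_last_def
  by (rule finite_subset[OF _ finite_permutations[of "{1..n}"]]) auto

lemma finite_descents [simp]: "finite (descents n \<sigma>)"
  by (rule finite_subset[of _ "{1..<n}"]) (auto simp: descents_def)

lemma card_descents_less:
  assumes "n \<ge> 1"
  shows "card (descents n \<sigma>) < n"
proof -
  have "card (descents n \<sigma>) \<le> card {1..<n}"
    by (rule card_mono) (auto simp: descents_def)
  then show ?thesis
    using assms by simp
qed

text \<open>Grouping permutations by their number of descents turns the coefficients into a sum over
  permutations, on which bijections can act. The range up to \<open>n\<close> misses none, since
  \<open>n >= 1\<close> bounds the descents by \<open>n - 1\<close>.\<close>

lemma sum_eulerian_last:
  fixes F :: "nat \<Rightarrow> 'a :: semiring_1"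
  assumes "n \<ge> 1"
  shows "(\<Sum>i=0..n. of_nat (eulerian_last n i k) * F i) =
         (\<Sum>\<sigma>\<in>perms_last n k. F (card (descents n \<sigma>)))"
proof -
  have "(\<Sum>\<sigma>\<in>perms_last n k. F (card (descents n \<sigma>))) =
        (\<Sum>i=0..n. \<Sum>\<sigma>\<in>{\<sigma>\<in>perms_last n k. card (descents n \<sigma>) = i}. F (card (descents n \<sigma>)))"
    using card_descents_less[OF assms] by (intro sum.group[symmetric]) (auto simp: less_imp_le)
  also have "\<dots> = (\<Sum>i=0..n. of_nat (eulerian_last n i k) * F i)"
  proof (rule sum.cong[OF refl])
    fix i
    have "{\<sigma>\<in>perms_last n k. card (descents n \<sigma>) = i} =
          {\<sigma>. \<sigma> permutes {1..n} \<and> card (descents n \<sigma>) = i \<and> \<sigma> n = k}"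
      by (auto simp: perms_last_def)
    then show "(\<Sum>\<sigma>\<in>{\<sigma>\<in>perms_last n k. card (descents n \<sigma>) = i}. F (card (descents n \<sigma>))) =
          of_nat (eulerian_last n i k) * F i"
      by (simp add: eulerian_last_def)
  qed
  finally show ?thesis ..
qed

text \<open>The cycle k -> k+1 -> ... -> n+1 -> k, undoing standardization: it frees the value
  \<open>k\<close> among the first \<open>n\<close> letters and gives it to the letter n+1.\<close>

definition cycle_up :: "nat \<Rightarrow> nat \<Rightarrow> nat \<Rightarrow> nat" where
  "cycle_up n k v = (if k \<le> v \<and> v \<le> n then Suc v else if v = Suc n then k else v)"

lemma cycle_up_permutes:
  assumes "1 \<le> k" and "k \<le> Suc n"
  shows "cycle_up n k permutes {1..Suc n}"
proof (rule bij_imp_permutes)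
  have "inj_on (cycle_up n k) {1..Suc n}"
    using assms by (auto simp: inj_on_def cycle_up_def split: if_splits)
  moreover have "cycle_up n k ` {1..Suc n} \<subseteq> {1..Suc n}"
    using assms by (auto simp: cycle_up_def)
  ultimately show "bij_betw (cycle_up n k) {1..Suc n} {1..Suc n}"
    by (simp add: bij_betw_def endo_inj_surj)
qed (use assms in \<open>auto simp: cycle_up_def\<close>)

text \<open>A permutation of [n] fixes n+1, so relabelling its values by the cycle makes
  \<open>k\<close> the last letter. Conversely, undoing the relabelling leaves n+1 fixed, hence a
  permutation of [n].\<close>

lemma bij_betw_perms_last_Suc:
  assumes "1 \<le> k" and "k \<le> Suc n"
  shows "bij_betw (\<lambda>\<tau>. cycle_up n k \<circ> \<tau>) {\<tau>. \<tau> permutes {1..n}} (perms_last (Suc n) k)"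
proof (rule bij_betw_byWitness[where f' = "\<lambda>\<sigma>. inv (cycle_up n k) \<circ> \<sigma>"])
  note c = cycle_up_permutes[OF assms]
  show "\<forall>\<tau>\<in>{\<tau>. \<tau> permutes {1..n}}. inv (cycle_up n k) \<circ> (cycle_up n k \<circ> \<tau>) = \<tau>"
    using permutes_inv_o(2)[OF c] by (simp add: o_assoc)
  show "\<forall>\<sigma>\<in>perms_last (Suc n) k. cycle_up n k \<circ> (inv (cycle_up n k) \<circ> \<sigma>) = \<sigma>"
    using permutes_inv_o(1)[OF c] by (simp add: o_assoc)
  show "(\<lambda>\<tau>. cycle_up n k \<circ> \<tau>) ` {\<tau>. \<tau> permutes {1..n}} \<subseteq> perms_last (Suc n) k"
  proof safe
    fix \<tau> assume t: "\<tau> permutes {1..n}"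
    have "\<tau> permutes {1..Suc n}"
      using t by (rule permutes_subset) auto
    then have "cycle_up n k \<circ> \<tau> permutes {1..Suc n}"
      using c by (rule permutes_compose)
    moreover have "\<tau> (Suc n) = Suc n"
      using t by (rule permutes_not_in) auto
    ultimately show "cycle_up n k \<circ> \<tau> \<in> perms_last (Suc n) k"
      by (simp add: perms_last_def cycle_up_def)
  qed
  show "(\<lambda>\<sigma>. inv (cycle_up n k) \<circ> \<sigma>) ` perms_last (Suc n) k \<subseteq> {\<tau>. \<tau> permutes {1..n}}"
  proof safe
    fix \<sigma> assume s: "\<sigma> \<in> perms_last (Suc n) k"
    then have p: "inv (cycle_up n k) \<circ> \<sigma> permutes {1..Suc n}"
      using permutes_inv[OF c] by (auto simp: perms_last_def intro: permutes_compose)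
    have "cycle_up n k (Suc n) = k"
      by (simp add: cycle_up_def)
    then have "inv (cycle_up n k) k = Suc n"
      using c by (simp add: permutes_inv_eq)
    then have "(inv (cycle_up n k) \<circ> \<sigma>) (Suc n) = Suc n"
      using s by (simp add: perms_last_def)
    then show "inv (cycle_up n k) \<circ> \<sigma> permutes {1..n}"
      by (intro permutes_superset[OF p]) (auto simp: le_Suc_eq)
  qed
qed

text \<open>The cycle is strictly increasing on {1..n}, so descents before position \<open>n\<close>
  are unchanged. Position \<open>n\<close> becomes a descent exactly when the previous last letter
  is pushed above \<open>k\<close>.\<close>

lemma card_descents_cycle_up:
  assumes "1 \<le> n" and "\<tau> permutes {1..n}"
  shows "card (descents (Suc n) (cycle_up n k \<circ> \<tau>)) =
         card (descents n \<tau>) + (if k \<le> \<tau> n then 1 else 0)"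
proof -
  have in_range: "1 \<le> \<tau> j \<and> \<tau> j \<le> n" if "1 \<le> j" "j \<le> n" for j
    using permutes_in_image[OF assms(2), of j] that by auto
  have last: "\<tau> (Suc n) = Suc n"
    using assms(2) by (rule permutes_not_in) auto
  have "j \<in> descents (Suc n) (cycle_up n k \<circ> \<tau>) \<longleftrightarrow>
        j \<in> descents n \<tau> \<union> (if k \<le> \<tau> n then {n} else {})" for j
  proof (cases "1 \<le> j \<and> j < n")
    case True
    then show ?thesis
      using in_range[of j] in_range[of "Suc j"] by (auto simp: descents_def cycle_up_def)
  next
    case False
    then consider "j = n" | "j = 0 \<or> j > n"
      by linarith
    then show ?thesis
      using in_range[of n] assms(1) last by cases (auto simp: descents_def cycle_up_def)
  qed
  then have "descents (Suc n) (cycle_up n k \<circ> \<tau>) =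
             descents n \<tau> \<union> (if k \<le> \<tau> n then {n} else {})"
    by blast
  moreover have "n \<notin> descents n \<tau>"
    by (simp add: descents_def)
  ultimately show ?thesis
    by simp
qed

definition worpitzky_sum :: "nat \<Rightarrow> nat \<Rightarrow> 'a :: field_char_0 \<Rightarrow> 'a" where
  "worpitzky_sum n k y =
     (\<Sum>\<sigma>\<in>perms_last n k. (y + of_nat (card (descents n \<sigma>))) gchoose (n - 1))"

text \<open>The index set no longer depends on \<open>k\<close>, so sums for different
  \<open>k\<close> can be compared term by term.\<close>

lemma worpitzky_sum_Suc:
  assumes "1 \<le> n" and "1 \<le> k" and "k \<le> Suc n"
  shows "worpitzky_sum (Suc n) k y =
    (\<Sum>\<tau> | \<tau> permutes {1..n}.
       (y + of_nat (card (descents n \<tau>) + (if k \<le> \<tau> n then 1 else 0))) gchoose n)"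
proof -
  have "worpitzky_sum (Suc n) k y =
    (\<Sum>\<tau> | \<tau> permutes {1..n}.
       (y + of_nat (card (descents (Suc n) (cycle_up n k \<circ> \<tau>)))) gchoose n)"
    unfolding worpitzky_sum_def
    using sum.reindex_bij_betw[OF bij_betw_perms_last_Suc[OF assms(2,3)], symmetric] by simp
  also have "\<dots> = (\<Sum>\<tau> | \<tau> permutes {1..n}.
       (y + of_nat (card (descents n \<tau>) + (if k \<le> \<tau> n then 1 else 0))) gchoose n)"
    by (intro sum.cong refl) (simp only: mem_Collect_eq card_descents_cycle_up[OF assms(1)])
  finally show ?thesis .
qed

text \<open>Passing from \<open>k\<close> to \<open>Suc k\<close> affects only the terms with
  \<open>\<tau> n = k\<close>, whose descent count drops by one. By Pascal's rule each loses a
  binomial with lower index \<open>n - 1\<close>, and these losses add up to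
  \<open>worpitzky_sum n k y\<close>.\<close>

lemma worpitzky_sum_step:
  assumes "1 \<le> k" and "k \<le> n"
  shows "worpitzky_sum (Suc n) k y = worpitzky_sum (Suc n) (Suc k) y + worpitzky_sum n k y"
proof -
  from assms obtain m where n: "n = Suc m"
    by (cases n) auto
  then have pred: "n - 1 = m"
    by simp
  let ?P = "{\<tau>. \<tau> permutes {1..n}}"
  let ?d = "\<lambda>\<tau>. of_nat (card (descents n \<tau>))"
  let ?c = "\<lambda>k \<tau>. (y + of_nat (card (descents n \<tau>) + (if k \<le> \<tau> n then 1 else 0))) gchoose n"
  have fin: "finite ?P"
    by (simp add: finite_permutations)
  have "perms_last n k = {\<tau>\<in>?P. \<tau> n = k}"
    by (auto simp: perms_last_def)
  then have "worpitzky_sum n k y = (\<Sum>\<tau>\<in>?P. if \<tau> n = k then (y + ?d \<tau>) gchoose m else 0)"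
    unfolding worpitzky_sum_def by (simp only: sum.inter_filter[OF fin] pred)
  moreover have "?c k \<tau> = ?c (Suc k) \<tau> + (if \<tau> n = k then (y + ?d \<tau>) gchoose m else 0)" for \<tau>
    using gbinomial_Suc_Suc[of "y + ?d \<tau>" m] by (auto simp: n add_ac)
  ultimately show ?thesis
    using assms by (simp add: worpitzky_sum_Suc sum.distrib[symmetric] del: of_nat_add)
qed

text \<open>Appending 1 always creates a descent and appending n+1 never does; one extra descent has
  the same effect as shifting \<open>y\<close> by 1.\<close>

lemma worpitzky_sum_first_last:
  assumes "1 \<le> n"
  shows "worpitzky_sum (Suc n) 1 y = worpitzky_sum (Suc n) (Suc n) (y + 1)"
proof -
  have "1 \<le> \<tau> n \<and> \<not> Suc n \<le> \<tau> n" if "\<tau> permutes {1..n}" for \<tau>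
    using permutes_in_image[OF that, of n] assms by auto
  then show ?thesis
    using assms by (auto simp: worpitzky_sum_Suc add_ac intro!: sum.cong)
qed

text \<open>No descent is added, so every term is an ordinary binomial d choose n with d <
  n.\<close>

lemma worpitzky_sum_last_zero:
  assumes "1 \<le> n"
  shows "worpitzky_sum (Suc n) (Suc n) 0 = 0"
proof -
  have "\<not> Suc n \<le> \<tau> n" if "\<tau> permutes {1..n}" for \<tau>
    using permutes_in_image[OF that, of n] assms by auto
  then show ?thesis
    using assms card_descents_less[OF assms]
    by (auto simp: worpitzky_sum_Suc binomial_gbinomial[symmetric] binomial_eq_0
        intro!: sum.neutral)
qed

lemma worpitzky_sum_1: "worpitzky_sum 1 1 y = 1"
proof -
  have "perms_last 1 1 = {id}"
    by (auto simp: perms_last_def)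
  then show ?thesis
    by (simp add: worpitzky_sum_def)
qed

lemma worpitzky_sum_of_nat:
  assumes "1 \<le> k" and "k \<le> n"
  shows "worpitzky_sum n k (of_nat m :: 'a :: field_char_0) =
         (of_nat m + 1) ^ (n - k) * of_nat m ^ (k - 1)"
proof -
  have "1 \<le> n"
    using assms by simp
  then show ?thesis
    using assms
  proof (induction n arbitrary: k m rule: dec_induct)
    case base
    then show ?case
      using worpitzky_sum_1 by simp
  next
    case (step n)
    note IH_n = step.IH
    \<comment> \<open>Downward induction on \<open>j\<close>, conditional on the value at
      \<open>j = Suc n\<close>. It serves twice: at \<open>j = 1\<close> inside the induction on
      \<open>m\<close> that establishes this condition, then for all \<open>j\<close>.\<close>
    have from_last: "worpitzky_sum (Suc n) j (of_nat m :: 'a) =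
        (of_nat m + 1) ^ (Suc n - j) * of_nat m ^ (j - 1)"
      if "worpitzky_sum (Suc n) (Suc n) (of_nat m :: 'a) = of_nat m ^ n" "j \<le> Suc n" "1 \<le> j" for j m
      using that(2,3)
    proof (induction j rule: inc_induct)
      case base
      then show ?case
        using that(1) by simp
    next
      case (step j)
      have IH: "worpitzky_sum n j (of_nat m :: 'a) = (of_nat m + 1) ^ (n - j) * of_nat m ^ (j - 1)"
        using step.prems step.hyps by (intro IH_n) auto
      obtain i where j: "j = Suc i"
        using step.prems by (cases j) auto
      have "worpitzky_sum (Suc n) j (of_nat m :: 'a) =
            (of_nat m + 1) ^ (n - j) * of_nat m ^ j + (of_nat m + 1) ^ (n - j) * of_nat m ^ (j - 1)"
        using worpitzky_sum_step[of j n "of_nat m :: 'a"] step IH by simp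
      \<comment> \<open>As \<open>j >= 1\<close>, both terms share the power with exponent
        \<open>j - 1\<close>; what remains is the factor m + 1.\<close>
      also have "\<dots> = (of_nat m + 1) ^ Suc (n - j) * of_nat m ^ (j - 1)"
        by (simp add: j algebra_simps)
      also have "Suc (n - j) = Suc n - j"
        using step.hyps by simp
      finally show ?case .
    qed
    have "worpitzky_sum (Suc n) (Suc n) (of_nat m :: 'a) = of_nat m ^ n" for m
    proof (induction m)
      case 0
      show ?case
        using worpitzky_sum_last_zero[OF step.hyps(1)] step.hyps(1) by (simp add: power_0_left)
    next
      case (Suc m)
      \<comment> \<open>The value at m + 1 for the largest last letter is the value at m for the
        smallest, which \<open>from_last\<close> supplies from the hypothesis for m.\<close>
      have "worpitzky_sum (Suc n) (Suc n) (of_nat (Suc m) :: 'a) = worpitzky_sum (Suc n) 1 (of_nat m)"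
        using worpitzky_sum_first_last[OF step.hyps(1), of "of_nat m :: 'a"] by (simp add: add_ac)
      also have "\<dots> = of_nat (Suc m) ^ n"
        using from_last[OF Suc, of 1] by (simp add: add_ac)
      finally show ?case .
    qed
    then show ?case
      using from_last step.prems by blast
  qed
qed

text \<open>Otherwise the difference would have infinitely many roots, the naturals being distinct
  in characteristic 0.\<close>

lemma poly_eqI_of_nat:
  fixes p q :: "'a :: field_char_0 poly"
  assumes "\<And>m. poly p (of_nat m) = poly q (of_nat m)"
  shows "p = q"
proof (rule ccontr)
  assume "p \<noteq> q"
  then have "finite {a. poly (p - q) a = 0}"
    by (intro poly_roots_finite) simp
  moreover have "range of_nat \<subseteq> {a. poly (p - q) a = 0}"
    using assms by auto
  ultimately have "finite (range (of_nat :: nat \<Rightarrow> 'a))"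
    by (rule finite_subset[rotated])
  then show False
    using range_inj_infinite[OF inj_of_nat] by blast
qed

text \<open>The exponent of x + 1 is \<open>n - k\<close>, not n - k + 1: the binomials on the right
  have degree \<open>n - 1\<close>, and for n = k = 1 both sides equal 1.\<close>

theorem theorem14:
  fixes n k :: nat and x :: "'a :: field_char_0 poly"
  defines "x \<equiv> [:0, 1:]"
  assumes "1 \<le> k" and "k \<le> n"
  shows "(x + 1) ^ (n - k) * x ^ (k - 1) =
         (\<Sum>i=0..n. of_nat (eulerian_last n i k) * poly_binomial (x + of_nat i) (n - 1))"
proof (rule poly_eqI_of_nat)
  fix m
  have "poly (\<Sum>i=0..n. of_nat (eulerian_last n i k) * poly_binomial (x + of_nat i) (n - 1))
          (of_nat m) =
        (\<Sum>i=0..n. of_nat (eulerian_last n i k) * ((of_nat m + of_nat i) gchoose (n - 1)))"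
    by (simp add: poly_sum poly_poly_binomial x_def)
  also have "\<dots> = worpitzky_sum n k (of_nat m)"
    unfolding worpitzky_sum_def using assms by (intro sum_eulerian_last) simp
  also have "\<dots> = poly ((x + 1) ^ (n - k) * x ^ (k - 1)) (of_nat m)"
    using assms(2,3) by (simp add: worpitzky_sum_of_nat x_def add_ac)
  finally show "poly ((x + 1) ^ (n - k) * x ^ (k - 1)) (of_nat m) =
    poly (\<Sum>i=0..n. of_nat (eulerian_last n i k) * poly_binomial (x + of_nat i) (n - 1))
      (of_nat m)" ..
qed

end
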